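(* Let $q\in\mathbb{C}$ with $0<|q|<1$. In the algebra $\mathcal{A}_q(4)$ of four mutually commuting $q$-oscillators $\{A_i^\pm,A_i^0\}_{i=1}^4$, set $$M^+ = \big( q^{A_2^0+\frac12} (A_1^+)^2 + (A_2^+)^2 \big)\big( q^{A_4^0+\frac12} (A_3^-)^2 + (A_4^-)^2 \big),$$ $$M^- = \big( q^{A_2^0+\frac12} (A_1^-)^2 + (A_2^-)^2 \big)\big( q^{A_4^0+\frac12} (A_3^+)^2 + (A_4^+)^2 \big),$$ $$L=(A_1^0+A_2^0)-(A_3^0+A_4^0),\qquad H=\sum_{i=1}^4\big(A_i^0+\tfrac12\big),$$ $$\mathscr{L}_{i,i+1}= q^{-\frac{1}{2}A_i^0+\frac{1}{4}} \big( q^{\frac{1}{4}}A_i^+A_{i+1}^- - q^{-\frac{1}{4}}A_i^-A_{i+1}^+ \big),\qquad i=1,3.$$ Then $$[L,M^\pm]=\pm4M^\pm,$$ \begin{align*} [M^+,M^-] &= \frac{1+q}{q(1-q)^3}\, q^H \Big( (q+q^{-1})(q^L-q^{-L}) - 2 \big( q^{\frac{1}{2}H}+q^{-\frac{1}{2}H} \big)\big(q^{\frac{1}{2}L}-q^{-\frac{1}{2}L}\big) \Big) \\ &\quad + \frac{1+q}{q^2(1-q)}\, q^H \Big( \big( q^{-\frac{1}{2}H} \mathscr{L}_{12}^2 + q^{\frac{1}{2}H} \mathscr{L}_{34}^2 \big) q^{\frac{1}{2}L} - \big( q^{\frac{1}{2}H} \mathscr{L}_{12}^2 + q^{-\frac{1}{2}H}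 \mathscr{L}_{34}^2 \big) q^{-\frac{1}{2}L} \Big), \end{align*} and the elements $\mathscr{L}_{12}$, $\mathscr{L}_{34}$ and $H$ are central, i.e. they commute with one another and with $M^+$, $M^-$ and $L$.
   Context: The $q$-oscillator algebra $\mathcal{A}_q(n)$ is the unital associative algebra over $\mathbb{C}$ generated by $n$ independent sets of $q$-oscillators $\{A_i^\pm,A_i^0\}$, $i=1,\dots,n$, with relations $$[A_i^0,A_i^\pm]=\pm A_i^\pm,\qquad [A_i^-,A_i^+]=q^{A_i^0},\qquad A_i^-A_i^+-qA_i^+A_i^-=1,$$ elements with different indices commuting. In particular $A_i^+A_i^-=(1-q^{A_i^0})/(1-q)$. A logarithm of $q$ is fixed so that the powers $q^{\lambda}$ are defined. The elements $q^{\lambda A_i^0}$ ($\lambda\in\mathbb{C}$) are included in the algebra and satisfy $q^{\lambda A_i^0}A_i^\pm=q^{\pm\lambda}A_i^\pm q^{\lambda A_i^0}$; exponentials such as $q^{\lambda L}$, $q^{\lambda H}$ are the corresponding products. Concretely, these are operators on the space spanned by occupancy number states $|n_1,\dots,n_n\rangle$ ($n_i\in\mathbb{N}=\{0,1,2,\dots\}$), with $A_i^\pm,A_i^0$ acting on the $i$-th factor by $$A_i^0|n_i\rangle=n_i|n_i\rangle,\qquad A_i^+|n_i\rangle=\sqrt{\tfrac{1-q^{n_i+1}}{1-q}}\,|n_i+1\rangle,\qquad A_i^-|n_i\rangle=\sqrt{\tfrac{1-q^{n_i}}{1-q}}\,|n_i-1\rangle,$$ and $q^{\lambda A_i^0}|n_i\rangle=q^{\lambda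 n_i}|n_i\rangle$. Here $[a,b]=ab-ba$. *)

theory Defs
  imports
    "HOL-Analysis.Analysis"
    "HOL-Library.Poly_Mapping"
    "HOL-Library.Numeral_Type"
begin

text \<open>
  The algebra is given by generators and relations, as the free complex algebra on the
  generators modulo a two-sided ideal. The free algebra is the monoid algebra of the free
  monoid of words: finitely supported functions from words to complex numbers, multiplied by
  convolution. The library requires the monoid of exponents to be written additively, hence
  the following instance, in which addition of lists is concatenation.
\<close>

instantiation list :: (type) monoid_add
begin

definition zero_list :: "'a list" where "zero_list = []"

definition plus_list :: "'a list \<Rightarrow> 'a list \<Rightarrow> 'a list" where "plus_list = append"

instance by standard (simp_all add: zero_list_def plus_list_def)

end

text \<open>
  The oscillators are indexed by a type \<open>'i\<close>, so an index type with \<open>n\<close> elements gives the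
  algebra of \<open>n\<close> oscillators. The generator \<open>QNum c i\<close> is the element \<open>q\<close> to the power \<open>c * Num i\<close>.
\<close>

datatype 'i osc_gen = Raise 'i | Lower 'i | Num 'i | QNum complex 'i

fun osc_index :: "'i osc_gen \<Rightarrow> 'i" where
  "osc_index (Raise i) = i"
| "osc_index (Lower i) = i"
| "osc_index (Num i) = i"
| "osc_index (QNum c i) = i"

type_synonym 'i osc_free = "'i osc_gen list \<Rightarrow>\<^sub>0 complex"

definition gen :: "'i osc_gen \<Rightarrow> 'i osc_free" where
  "gen g = Poly_Mapping.single [g] 1"

definition scal :: "complex \<Rightarrow> 'i osc_free" where
  "scal c = Poly_Mapping.single 0 c"

abbreviation Ap :: "'i \<Rightarrow> 'i osc_free" where "Ap i \<equiv> gen (Raise i)"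
abbreviation Am :: "'i \<Rightarrow> 'i osc_free" where "Am i \<equiv> gen (Lower i)"
abbreviation A0 :: "'i \<Rightarrow> 'i osc_free" where "A0 i \<equiv> gen (Num i)"
abbreviation qA0 :: "complex \<Rightarrow> 'i \<Rightarrow> 'i osc_free" where "qA0 c i \<equiv> gen (QNum c i)"

definition commutator :: "'a::ring \<Rightarrow> 'a \<Rightarrow> 'a" where
  "commutator a b = a * b - b * a"

text \<open>
  Below, \<open>h\<close> is the chosen logarithm of \<open>q\<close>, so \<open>q = exp h\<close>; it determines all complex powers
  of \<open>q\<close>.
\<close>

definition qpow :: "complex \<Rightarrow> complex \<Rightarrow> complex" where
  "qpow h c = exp (c * h)"

text \<open>
  The defining relations, each written as an element that is set to zero. The relations
  \<open>q_zero\<close>, \<open>q_add\<close> and \<open>q_num\<close> are the laws of exponents implicit in the notation for the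
  powers of \<open>q\<close>.
\<close>

inductive_set osc_relators :: "complex \<Rightarrow> 'i osc_free set" for h :: complex where
  num_raise: "commutator (A0 i) (Ap i) - Ap i \<in> osc_relators h"
| num_lower: "commutator (A0 i) (Am i) + Am i \<in> osc_relators h"
| lower_raise: "commutator (Am i) (Ap i) - qA0 1 i \<in> osc_relators h"
| q_lower_raise: "Am i * Ap i - scal (exp h) * Ap i * Am i - 1 \<in> osc_relators h"
| q_raise: "qA0 c i * Ap i - scal (qpow h c) * Ap i * qA0 c i \<in> osc_relators h"
| q_lower: "qA0 c i * Am i - scal (qpow h (- c)) * Am i * qA0 c i \<in> osc_relators h"
| q_zero: "qA0 0 i - 1 \<in> osc_relators h"
| q_add: "qA0 (c + d) i - qA0 c i * qA0 d i \<in> osc_relators h"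
| q_num: "commutator (A0 i) (qA0 c i) \<in> osc_relators h"
| indep: "osc_index a \<noteq> osc_index b \<Longrightarrow> commutator (gen a) (gen b) \<in> osc_relators h"

inductive_set osc_ideal :: "complex \<Rightarrow> 'i osc_free set" for h :: complex where
  zero: "0 \<in> osc_ideal h"
| relator: "r \<in> osc_relators h \<Longrightarrow> x * r * y \<in> osc_ideal h"
| add: "u \<in> osc_ideal h \<Longrightarrow> v \<in> osc_ideal h \<Longrightarrow> u + v \<in> osc_ideal h"

text \<open>Equality in the quotient algebra of the classes of two elements of the free algebra.\<close>

definition osc_eq :: "'i osc_free \<Rightarrow> complex \<Rightarrow> 'i osc_free \<Rightarrow> bool"
    ("(_ \<approx>\<^bsub>_\<^esub>/ _)" [51, 0, 51] 50) where
  "x \<approx>\<^bsub>h\<^esub> y \<longleftrightarrow> x - y \<in> osc_ideal h"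

text \<open>
  Four oscillators are indexed by the type \<open>4\<close>, whose elements are the residues modulo \<open>4\<close>.
  The numerals from \<open>1\<close> to \<open>4\<close> denote its four elements, with \<open>4 = 0\<close>.
\<close>

lemma index_four: "distinct [1, 2, 3, 4 :: 4]" "(UNIV :: 4 set) = {1, 2, 3, 4}"
proof -
  show d: "distinct [1, 2, 3, 4 :: 4]" by simp
  have "card {1, 2, 3, 4 :: 4} = CARD(4)" using distinct_card[OF d] by simp
  then show "(UNIV :: 4 set) = {1, 2, 3, 4}"
    by (metis card_subset_eq finite_class.finite_UNIV subset_UNIV)
qed

definition Mplus :: "complex \<Rightarrow> 4 osc_free" where
  "Mplus h =
     (scal (qpow h (1/2)) * qA0 1 2 * (Ap 1)^2 + (Ap 2)^2) *
     (scal (qpow h (1/2)) * qA0 1 4 * (Am 3)^2 + (Am 4)^2)"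

definition Mminus :: "complex \<Rightarrow> 4 osc_free" where
  "Mminus h =
     (scal (qpow h (1/2)) * qA0 1 2 * (Am 1)^2 + (Am 2)^2) *
     (scal (qpow h (1/2)) * qA0 1 4 * (Ap 3)^2 + (Ap 4)^2)"

definition Lnum :: "4 osc_free" where
  "Lnum = (A0 1 + A0 2) - (A0 3 + A0 4)"

definition Hnum :: "4 osc_free" where
  "Hnum = (\<Sum>i\<in>UNIV. A0 i + scal (1/2))"

definition Lrot :: "complex \<Rightarrow> 4 \<Rightarrow> 4 osc_free" where
  "Lrot h i =
     scal (qpow h (1/4)) * qA0 (- 1/2) i *
     (scal (qpow h (1/4)) * Ap i * Am (i + 1) - scal (qpow h (- 1/4)) * Am i * Ap (i + 1))"

text \<open>The powers of \<open>q\<close> with exponent \<open>c * Lnum\<close> and \<open>c * Hnum\<close>.\<close>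

definition qL :: "complex \<Rightarrow> 4 osc_free" where
  "qL c = qA0 c 1 * qA0 c 2 * qA0 (- c) 3 * qA0 (- c) 4"

definition qH :: "complex \<Rightarrow> complex \<Rightarrow> 4 osc_free" where
  "qH h c = scal (qpow h (2 * c)) * qA0 c 1 * qA0 c 2 * qA0 c 3 * qA0 c 4"

end

theory Submission
  imports Defs
begin

text \<open>
  Both ladder operators are products of commuting factors for the pairs of oscillators
  \<open>(1,2)\<close> and \<open>(3,4)\<close>. For one pair, let \<open>X\<^sup>+\<close> and \<open>X\<^sup>-\<close> be these factors, \<open>K\<close> the power of \<open>q\<close> with
  exponent the total number operator of the pair, and \<open>R\<close> the operator \<open>Lrot\<close> of the pair.
  Then \<open>R\<close> commutes with \<open>X\<^sup>+\<close>, \<open>X\<^sup>-\<close> and \<open>K\<close>, and normal ordering yields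
  \<open>X\<^sup>+X\<^sup>- = ((1 - K) / (1 - q))\<^sup>2 + K R\<^sup>2 / q\<close> and
  \<open>X\<^sup>-X\<^sup>+ = ((1 - q\<^sup>2 K) / (1 - q))\<^sup>2 + q K R\<^sup>2\<close>.
  As the two pairs commute, the commutator of the ladder operators is obtained from an identity
  in commuting variables.
\<close>

section \<open>Scalars, the relation ideal and its congruence in the free algebra\<close>

lemma scal_mult: "scal a * scal b = (scal (a * b) :: 'i osc_free)"
  by (simp add: scal_def mult_single)

lemma scal_add: "scal a + scal b = (scal (a + b) :: 'i osc_free)"
  by (simp add: scal_def single_add)

lemma scal_one: "(scal 1 :: 'i osc_free) = 1"
  by (simp add: scal_def)

lemma scal_gen: "gen g * scal c = scal c * gen g"
  by (simp add: scal_def gen_def mult_single)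

lemma osc_ideal_mult_left: "u \<in> osc_ideal h \<Longrightarrow> w * u \<in> osc_ideal h"
proof (induction rule: osc_ideal.induct)
  case zero
  then show ?case by (simp add: osc_ideal.zero)
next
  case (relator r x y)
  then show ?case using osc_ideal.relator[of r h "w * x" y] by (simp add: mult.assoc)
next
  case (add u v)
  then show ?case by (simp add: distrib_left osc_ideal.add)
qed

lemma osc_ideal_mult_right: "u \<in> osc_ideal h \<Longrightarrow> u * w \<in> osc_ideal h"
proof (induction rule: osc_ideal.induct)
  case zero
  then show ?case by (simp add: osc_ideal.zero)
next
  case (relator r x y)
  then show ?case using osc_ideal.relator[of r h x "y * w"] by (simp add: mult.assoc)
next
  case (add u v)
  then show ?case by (simp add: distrib_right osc_ideal.add)
qed

lemma osc_ideal_uminus: "u \<in> osc_ideal h \<Longrightarrow> - u \<in> osc_ideal h"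
  using osc_ideal_mult_left[of u h "- 1"] by simp

lemma osc_relator_mem: "r \<in> osc_relators h \<Longrightarrow> r \<in> osc_ideal h"
  using osc_ideal.relator[of r h 1 1] by simp

lemma osc_eq_refl: "x \<approx>\<^bsub>h\<^esub> x"
  by (simp add: osc_eq_def osc_ideal.zero)

lemma osc_eq_sym: "x \<approx>\<^bsub>h\<^esub> y \<Longrightarrow> y \<approx>\<^bsub>h\<^esub> x"
  unfolding osc_eq_def using osc_ideal_uminus by fastforce

lemma osc_eq_trans: "x \<approx>\<^bsub>h\<^esub> y \<Longrightarrow> y \<approx>\<^bsub>h\<^esub> z \<Longrightarrow> x \<approx>\<^bsub>h\<^esub> z"
  unfolding osc_eq_def using osc_ideal.add[of "x - y" h "y - z"] by simp

lemma osc_eq_add: "x \<approx>\<^bsub>h\<^esub> x' \<Longrightarrow> y \<approx>\<^bsub>h\<^esub> y' \<Longrightarrow> x + y \<approx>\<^bsub>h\<^esub> x' + y'"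
  unfolding osc_eq_def using osc_ideal.add[of "x - x'" h "y - y'"] by (simp add: algebra_simps)

lemma osc_eq_uminus: "x \<approx>\<^bsub>h\<^esub> x' \<Longrightarrow> - x \<approx>\<^bsub>h\<^esub> - x'"
  unfolding osc_eq_def using osc_ideal_uminus[of "x - x'" h] by simp

lemma osc_eq_mult:
  assumes "x \<approx>\<^bsub>h\<^esub> x'" "y \<approx>\<^bsub>h\<^esub> y'"
  shows "x * y \<approx>\<^bsub>h\<^esub> x' * y'"
proof -
  have "x * y - x' * y' = (x - x') * y + x' * (y - y')"
    by (simp add: algebra_simps)
  with assms show ?thesis
    unfolding osc_eq_def
    using osc_ideal.add osc_ideal_mult_left osc_ideal_mult_right by metis
qed

\<comment> \<open>The quotient ring of families\<close>
text \<open>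
  A type cannot depend on \<open>h\<close>, so the quotient algebras for all \<open>h\<close> are formed at once: an
  element of the following ring is a family of elements of these algebras. The values of \<open>h\<close>
  for which \<open>1 - q\<close> vanishes are disregarded.
\<close>

quotient_type 'i osc = "complex \<Rightarrow> 'i osc_free" /
  "\<lambda>f g. \<forall>h. exp h \<noteq> 1 \<longrightarrow> f h \<approx>\<^bsub>h\<^esub> g h"
  morphisms rep_osc osc
proof (rule equivpI)
  show "reflp (\<lambda>f g. \<forall>h. exp h \<noteq> 1 \<longrightarrow> f h \<approx>\<^bsub>h\<^esub> g h)"
    by (rule reflpI) (blast intro: osc_eq_refl)
  show "symp (\<lambda>f g. \<forall>h. exp h \<noteq> 1 \<longrightarrow> f h \<approx>\<^bsub>h\<^esub> g h)"
    by (rule sympI) (blast intro: osc_eq_sym)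
  show "transp (\<lambda>f g. \<forall>h. exp h \<noteq> 1 \<longrightarrow> f h \<approx>\<^bsub>h\<^esub> g h)"
    by (rule transpI) (blast intro: osc_eq_trans)
qed

instantiation osc :: (type) "{ring, monoid_mult}"
begin

lift_definition zero_osc :: "'a osc" is "\<lambda>h. 0" .
lift_definition one_osc :: "'a osc" is "\<lambda>h. 1" .
lift_definition plus_osc :: "'a osc \<Rightarrow> 'a osc \<Rightarrow> 'a osc" is "\<lambda>f g h. f h + g h"
  by (simp add: osc_eq_add)
lift_definition uminus_osc :: "'a osc \<Rightarrow> 'a osc" is "\<lambda>f h. - f h"
  by (simp add: osc_eq_uminus)
lift_definition minus_osc :: "'a osc \<Rightarrow> 'a osc \<Rightarrow> 'a osc" is "\<lambda>f g h. f h - g h"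
  by (metis osc_eq_add osc_eq_uminus add_uminus_conv_diff)
lift_definition times_osc :: "'a osc \<Rightarrow> 'a osc \<Rightarrow> 'a osc" is "\<lambda>f g h. f h * g h"
  by (simp add: osc_eq_mult)

instance
  by standard (transfer; simp add: algebra_simps osc_eq_refl)+

end

lemma osc_eqI: "(\<And>h. exp h \<noteq> 1 \<Longrightarrow> f h \<approx>\<^bsub>h\<^esub> g h) \<Longrightarrow> osc f = osc g"
  by transfer simp

lemma osc_eqD: "osc f = osc g \<Longrightarrow> exp h \<noteq> 1 \<Longrightarrow> f h \<approx>\<^bsub>h\<^esub> g h"
  by transfer simp

lemma osc_one: "osc (\<lambda>h. 1) = 1"
  by transfer (simp add: osc_eq_refl)

lemma osc_plus: "osc (\<lambda>h. f h + g h) = osc f + osc g"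
  by transfer (simp add: osc_eq_refl)

lemma osc_minus: "osc (\<lambda>h. f h - g h) = osc f - osc g"
  by transfer (simp add: osc_eq_refl)

lemma osc_uminus: "osc (\<lambda>h. - f h) = - osc f"
  by transfer (simp add: osc_eq_refl)

lemma osc_times: "osc (\<lambda>h. f h * g h) = osc f * osc g"
  by transfer (simp add: osc_eq_refl)

lemma osc_power2: "osc (\<lambda>h. (f h)\<^sup>2) = osc f * osc f"
  by (simp add: power2_eq_square osc_times)

lemmas osc_hom = osc_one osc_plus osc_minus osc_uminus osc_times osc_power2

section \<open>Generators and relations in the quotient ring\<close>

definition up :: "'i \<Rightarrow> 'i osc" where "up i = osc (\<lambda>h. Ap i)"
definition dn :: "'i \<Rightarrow> 'i osc" where "dn i = osc (\<lambda>h. Am i)"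
definition num :: "'i \<Rightarrow> 'i osc" where "num i = osc (\<lambda>h. A0 i)"
definition qn :: "complex \<Rightarrow> 'i \<Rightarrow> 'i osc" where "qn c i = osc (\<lambda>h. qA0 c i)"
text \<open>Scalars are functions of \<open>h\<close>, because q itself varies along a
  family.\<close>

definition sc :: "(complex \<Rightarrow> complex) \<Rightarrow> 'i osc" where "sc f = osc (\<lambda>h. scal (f h))"
definition qp :: "complex \<Rightarrow> 'i osc" where "qp c = sc (\<lambda>h. qpow h c)"

text \<open>The inverse of 1 - q. The value that division by zero assigns at
  \<open>exp h = 1\<close> is invisible in \<open>osc\<close>.\<close>

definition qe :: "'i osc" where "qe = sc (\<lambda>h. 1 / (1 - exp h))"

lemmas osc_gens = up_def dn_def num_def qn_def sc_def

lemma osc_relation: "(\<And>h. f h - g h \<in> osc_relators h) \<Longrightarrow> osc f = osc g"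
  by (rule osc_eqI) (simp add: osc_eq_def osc_relator_mem)

lemma sc_mult: "sc f * sc g = sc (\<lambda>h. f h * g h)"
  by (simp add: sc_def osc_times[symmetric] scal_mult)

lemma sc_plus: "sc f + sc g = sc (\<lambda>h. f h + g h)"
  by (simp add: sc_def osc_plus[symmetric] scal_add)

lemma sc_one: "sc (\<lambda>h. 1) = 1"
  by (simp add: sc_def scal_one osc_one)

lemma sc_minus: "sc f - sc g = sc (\<lambda>h. f h - g h)"
  by (simp add: diff_eq_eq sc_plus)

lemma sc_cong: "(\<And>h. exp h \<noteq> 1 \<Longrightarrow> f h = g h) \<Longrightarrow> sc f = sc g"
  unfolding sc_def by (rule osc_eqI) (simp add: osc_eq_refl)

lemma qp_mult: "qp c * qp d = qp (c + d)"
  by (simp add: qp_def sc_mult qpow_def exp_add distrib_right)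

lemma qp_zero: "qp 0 = 1"
  by (simp add: qp_def qpow_def sc_one)

lemma qe_inverse: "qe * (1 - qp 1) = 1"
  unfolding qe_def qp_def sc_one[symmetric] sc_minus sc_mult
  by (rule sc_cong) (simp add: qpow_def)

lemma sc_commute: "up i * sc f = sc f * up i" "dn i * sc f = sc f * dn i"
  "num i * sc f = sc f * num i" "qn c i * sc f = sc f * qn c i"
  by (simp_all add: osc_gens osc_times[symmetric] scal_gen)

lemma num_up: "num i * up i = up i * num i + up i"
proof -
  have "num i * up i - up i * num i = up i"
    unfolding osc_gens osc_hom[symmetric]
    by (rule osc_relation) (use osc_relators.num_raise in \<open>simp add: commutator_def\<close>)
  then show ?thesis by (simp add: algebra_simps)
qed

lemma num_dn: "num i * dn i = dn i * num i - dn i"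
proof -
  have "num i * dn i - dn i * num i = - dn i"
    unfolding osc_gens osc_hom[symmetric]
    by (rule osc_relation) (use osc_relators.num_lower in \<open>simp add: commutator_def\<close>)
  then show ?thesis by (simp add: algebra_simps)
qed

lemma dn_up_commutator: "dn i * up i - up i * dn i = qn 1 i"
  unfolding osc_gens osc_hom[symmetric]
  by (rule osc_relation) (use osc_relators.lower_raise in \<open>simp add: commutator_def\<close>)

lemma dn_up_q_commutator: "dn i * up i - qp 1 * up i * dn i = 1"
  unfolding osc_gens qp_def osc_hom[symmetric]
  by (rule osc_relation) (use osc_relators.q_lower_raise in \<open>simp add: qpow_def\<close>)

lemma qn_up: "qn c i * up i = qp c * up i * qn c i"
  unfolding osc_gens qp_def osc_hom[symmetric]
  by (rule osc_relation, rule osc_relators.q_raise)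

lemma qn_dn: "qn c i * dn i = qp (- c) * dn i * qn c i"
  unfolding osc_gens qp_def osc_hom[symmetric]
  by (rule osc_relation, rule osc_relators.q_lower)

lemma qn_zero: "qn 0 i = 1"
  unfolding osc_gens osc_hom[symmetric]
  by (rule osc_relation, rule osc_relators.q_zero)

lemma qn_add: "qn c i * qn d i = qn (c + d) i"
  unfolding osc_gens osc_hom[symmetric]
  by (rule osc_relation[symmetric], rule osc_relators.q_add)

lemma num_qn: "num i * qn c i = qn c i * num i"
  unfolding osc_gens osc_hom[symmetric]
  by (rule osc_relation) (use osc_relators.q_num in \<open>simp add: commutator_def\<close>)

lemma gen_commute:
  assumes "osc_index a \<noteq> osc_index b"
  shows "osc (\<lambda>h. gen a) * osc (\<lambda>h. gen b) = osc (\<lambda>h. gen b) * osc (\<lambda>h. gen a)"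
  unfolding osc_hom[symmetric]
  by (rule osc_relation) (use osc_relators.indep[OF assms] in \<open>simp add: commutator_def\<close>)

text \<open>The two relations express \<open>dn i * up i\<close> in two ways; their difference gives
  \<open>up i * dn i\<close> multiplied by 1 - q, and \<open>qe\<close> cancels this factor.\<close>

lemma up_dn: "up i * dn i = qe - qe * qn 1 i"
proof -
  have "(1 - qp 1) * (up i * dn i) = 1 - qn 1 i"
    using dn_up_commutator[of i] dn_up_q_commutator[of i]
    by (simp add: algebra_simps)
  then have "qe * ((1 - qp 1) * (up i * dn i)) = qe * (1 - qn 1 i)"
    by simp
  then show ?thesis
    by (simp add: mult.assoc[symmetric] qe_inverse) (simp add: algebra_simps)
qed

lemma dn_up: "dn i * up i = qe - qe * (qp 1 * qn 1 i)"
proof -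
  \<comment> \<open>From q/(1-q) = 1/(1-q) - 1, the sum of q^N and (1 - q^N)/(1-q) collapses to (1 -
    q^(N+1))/(1-q).\<close>
  have "qe - qe * qp 1 = (1 :: 'a osc)"
    by (simp add: qe_inverse[unfolded right_diff_distrib mult_1_right])
  then have "qe * qp 1 = (qe - 1 :: 'a osc)"
    by (metis diff_diff_eq2 add_diff_cancel_left')
  then have "qe * (qp 1 * qn 1 i) = qe * qn 1 i - qn 1 i"
    by (simp add: mult.assoc[symmetric] left_diff_distrib)
  moreover have "dn i * up i = qn 1 i + up i * dn i"
    using dn_up_commutator[of i] by (simp add: diff_eq_eq)
  ultimately show ?thesis
    by (simp add: up_dn)
qed

lemma up_qn: "up i * qn c i = qp (- c) * (qn c i * up i)"
  by (simp add: qn_up mult.assoc[symmetric] qp_mult qp_zero)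

lemma dn_qn: "dn i * qn c i = qp c * (qn c i * dn i)"
  by (simp add: qn_dn mult.assoc[symmetric] qp_mult qp_zero)

lemma qp_commute: "up i * qp c = qp c * up i" "dn i * qp c = qp c * dn i"
  "num i * qp c = qp c * num i" "qn d i * qp c = qp c * qn d i"
  unfolding qp_def by (rule sc_commute)+

lemma qe_commute: "up i * qe = qe * up i" "dn i * qe = qe * dn i"
  "num i * qe = qe * num i" "qn d i * qe = qe * qn d i" "qp c * qe = qe * qp c"
  unfolding qe_def qp_def by (rule sc_commute)+ (simp add: sc_mult mult.commute)

lemma up_num: "up i * num i = num i * up i - up i"
  by (simp add: num_up)

lemma dn_num: "dn i * num i = num i * dn i + dn i"
  by (simp add: num_dn)

lemma distinct_commute:
  assumes "i \<noteq> j"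
  shows "up j * up i = up i * up j" "up j * dn i = dn i * up j"
    "dn j * up i = up i * dn j" "dn j * dn i = dn i * dn j"
    "up i * qn c j = qn c j * up i" "dn i * qn c j = qn c j * dn i"
    "up i * num j = num j * up i" "dn i * num j = num j * dn i"
    "qn c i * num j = num j * qn c i"
    "qn c j * qn d i = qn d i * qn c j" "num j * num i = num i * num j"
  using assms unfolding osc_gens by (intro gen_commute; simp)+

text \<open>Products are kept nested to the right, so a rule for \<open>x * y\<close> must also be
  supplied in the form that applies in front of a further factor.\<close>

lemma mult_left_eq: "x * y = z \<Longrightarrow> x * (y * w) = z * w" for x y z w :: "'a::semigroup_mult"
  by (simp add: mult.assoc[symmetric])

text \<open>
  Rewriting with these rules brings words into the normal form in which scalars precede the
  number operators and these precede at most one kind of ladder operator.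
\<close>

lemmas osc_normalize =
  qp_mult qp_mult[THEN mult_left_eq] qp_zero
  qp_commute qp_commute[THEN mult_left_eq] qe_commute qe_commute[THEN mult_left_eq]
  qn_add qn_add[THEN mult_left_eq] qn_zero
  up_qn up_qn[THEN mult_left_eq] dn_qn dn_qn[THEN mult_left_eq]
  up_dn up_dn[THEN mult_left_eq] dn_up dn_up[THEN mult_left_eq]
  up_num up_num[THEN mult_left_eq] dn_num dn_num[THEN mult_left_eq]
  num_qn[symmetric] num_qn[symmetric, THEN mult_left_eq]

section \<open>Operators of one pair of oscillators\<close>

definition raise2 :: "'i \<Rightarrow> 'i \<Rightarrow> 'i osc" where
  "raise2 i j = qp (1/2) * qn 1 j * up i * up i + up j * up j"

definition lower2 :: "'i \<Rightarrow> 'i \<Rightarrow> 'i osc" where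
  "lower2 i j = qp (1/2) * qn 1 j * dn i * dn i + dn j * dn j"

text \<open>This is \<open>Lrot\<close> with its outer scalar q^(1/4) absorbed: the inner scalars
  q^(1/4) and q^(-1/4) become q^(1/2) and 1.\<close>

definition rot :: "'i \<Rightarrow> 'i \<Rightarrow> 'i osc" where
  "rot i j = qn (- 1/2) i * (qp (1/2) * up i * dn j - dn i * up j)"

definition qnum2 :: "complex \<Rightarrow> 'i \<Rightarrow> 'i \<Rightarrow> 'i osc" where
  "qnum2 c i j = qn c i * qn c j"

context
  fixes i j :: 'i
  assumes ij: "i \<noteq> j"
begin

text \<open>Facts 5 to 9 of \<open>distinct_commute\<close> order different kinds of generators and
  can be used with both orders of the indices. The remaining facts sort by index, so adding their
  mirror images would make rewriting loop.\<close>

lemmas pair_normalize = osc_normalize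
  distinct_commute[OF ij] distinct_commute[OF ij, THEN mult_left_eq]
  distinct_commute(5-9)[OF ij[symmetric]] distinct_commute(5-9)[OF ij[symmetric], THEN mult_left_eq]

lemma rot_raise2: "rot i j * raise2 i j = raise2 i j * rot i j"
  by (simp add: rot_def raise2_def algebra_simps pair_normalize)

lemma rot_lower2: "rot i j * lower2 i j = lower2 i j * rot i j"
  by (simp add: rot_def lower2_def algebra_simps pair_normalize)

lemma rot_qnum2: "rot i j * qnum2 c i j = qnum2 c i j * rot i j"
  by (simp add: rot_def qnum2_def algebra_simps pair_normalize)

lemma qnum2_add: "qnum2 c i j * qnum2 d i j = qnum2 (c + d) i j"
  by (simp add: qnum2_def algebra_simps pair_normalize)

lemma rot_num: "rot i j * (num i + num j) = (num i + num j) * rot i j"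
  by (simp add: rot_def algebra_simps pair_normalize)

lemma raise2_num:
  "raise2 i j * (num i + num j) = (num i + num j) * raise2 i j - raise2 i j - raise2 i j"
  by (simp add: raise2_def algebra_simps pair_normalize)

lemma lower2_num:
  "lower2 i j * (num i + num j) = (num i + num j) * lower2 i j + lower2 i j + lower2 i j"
  by (simp add: lower2_def algebra_simps pair_normalize)

text \<open>The terms that raise one oscillator by two and lower the other by two are exactly those
  in the square of \<open>rot\<close>. All other terms reduce to polynomials in the powers of q by
  \<open>up_dn\<close> and \<open>dn_up\<close>.\<close>

lemma raise2_lower2:
  "raise2 i j * lower2 i j =
     qe * qe * (1 - qnum2 1 i j) * (1 - qnum2 1 i j) + qp (- 1) * qnum2 1 i j * (rot i j * rot i j)"
  by (simp add: raise2_def lower2_def rot_def qnum2_def algebra_simps pair_normalize)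

text \<open>The right side is that of \<open>raise2_lower2\<close> with K replaced by q^2 K, the
  shift incurred when K is moved to the left past \<open>lower2\<close>.\<close>

lemma lower2_raise2:
  "lower2 i j * raise2 i j =
     qe * qe * (1 - qp 2 * qnum2 1 i j) * (1 - qp 2 * qnum2 1 i j) + qp 1 * qnum2 1 i j * (rot i j * rot i j)"
  by (simp add: raise2_def lower2_def rot_def qnum2_def algebra_simps pair_normalize)

end

section \<open>Subalgebras generated by subsets of the oscillators\<close>

inductive_set osc_on :: "'i set \<Rightarrow> 'i osc set" for I :: "'i set" where
  osc_on_up: "i \<in> I \<Longrightarrow> up i \<in> osc_on I"
| osc_on_dn: "i \<in> I \<Longrightarrow> dn i \<in> osc_on I"
| osc_on_num: "i \<in> I \<Longrightarrow> num i \<in> osc_on I"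
| osc_on_qn: "i \<in> I \<Longrightarrow> qn c i \<in> osc_on I"
| osc_on_sc: "sc f \<in> osc_on I"
| osc_on_add: "x \<in> osc_on I \<Longrightarrow> y \<in> osc_on I \<Longrightarrow> x + y \<in> osc_on I"
| osc_on_diff: "x \<in> osc_on I \<Longrightarrow> y \<in> osc_on I \<Longrightarrow> x - y \<in> osc_on I"
| osc_on_mult: "x \<in> osc_on I \<Longrightarrow> y \<in> osc_on I \<Longrightarrow> x * y \<in> osc_on I"

lemma mult_commute_mult: "x * y = y * x \<Longrightarrow> x * z = z * x \<Longrightarrow> x * (y * z) = (y * z) * x"
  for x y z :: "'a::semigroup_mult"
  by (metis mult.assoc)

lemma sc_central: "x \<in> osc_on I \<Longrightarrow> sc f * x = x * sc f"
proof (induction rule: osc_on.induct)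
  case (osc_on_sc g)
  then show ?case by (simp add: sc_mult mult.commute)
next
  case (osc_on_mult x y)
  then show ?case by (intro mult_commute_mult)
qed (simp_all add: sc_commute distrib_left distrib_right left_diff_distrib right_diff_distrib)

lemma osc_on_gen_commute:
  assumes "y \<in> osc_on J" "osc_index a \<notin> J"
  shows "osc (\<lambda>h. gen a) * y = y * osc (\<lambda>h. gen a)"
  using assms
proof (induction rule: osc_on.induct)
  case (osc_on_sc f)
  show ?case
    by (simp add: sc_def osc_times[symmetric] scal_gen)
next
  case (osc_on_mult x y)
  then show ?case by (intro mult_commute_mult)
next
  case (osc_on_up i)
  then show ?case unfolding osc_gens by (intro gen_commute) auto
next
  case (osc_on_dn i)
  then show ?case unfolding osc_gens by (intro gen_commute) auto
next
  case (osc_on_num i)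
  then show ?case unfolding osc_gens by (intro gen_commute) auto
next
  case (osc_on_qn i c)
  then show ?case unfolding osc_gens by (intro gen_commute) auto
qed (simp_all add: distrib_left distrib_right left_diff_distrib right_diff_distrib)

text \<open>This lets operators of disjoint pairs be interchanged without expanding them. The
  induction runs over the first factor; its generator cases are \<open>osc_on_gen_commute\<close>,
  an induction over the second.\<close>

lemma osc_on_commute:
  assumes "x \<in> osc_on I" "y \<in> osc_on J" "I \<inter> J = {}"
  shows "x * y = y * x"
  using assms(1)
proof (induction rule: osc_on.induct)
  case (osc_on_sc f)
  show ?case by (rule sc_central[OF assms(2)])
next
  case (osc_on_mult x z)
  then show ?case using mult_commute_mult[of y x z] by simp
next
  case (osc_on_up i)
  then show ?case unfolding osc_gens using assms by (intro osc_on_gen_commute) auto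
next
  case (osc_on_dn i)
  then show ?case unfolding osc_gens using assms by (intro osc_on_gen_commute) auto
next
  case (osc_on_num i)
  then show ?case unfolding osc_gens using assms by (intro osc_on_gen_commute) auto
next
  case (osc_on_qn i c)
  then show ?case unfolding osc_gens using assms by (intro osc_on_gen_commute) auto
qed (simp_all add: distrib_left distrib_right left_diff_distrib right_diff_distrib)

lemma pair_osc_on:
  "raise2 i j \<in> osc_on {i, j}" "lower2 i j \<in> osc_on {i, j}" "rot i j \<in> osc_on {i, j}"
  "qnum2 c i j \<in> osc_on {i, j}" "num i + num j \<in> osc_on {i, j}"
  unfolding raise2_def lower2_def rot_def qnum2_def qp_def
  by (intro osc_on.intros insertI1 insertI2)+

lemma qnum2_zero: "qnum2 0 i j = 1"
  by (simp add: qnum2_def qn_zero)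

lemma pair_scalar:
  "rot i j * qp c = qp c * rot i j" "qnum2 d i j * qp c = qp c * qnum2 d i j"
  "rot i j * qe = qe * rot i j" "qnum2 d i j * qe = qe * qnum2 d i j"
  unfolding qp_def qe_def by (rule sc_central[OF pair_osc_on(3), symmetric] sc_central[OF pair_osc_on(4), symmetric])+

text \<open>
  The redundant factors \<open>qe * (1 - qp 1) = 1\<close> make the two sides agree as polynomials, so that
  expanding them suffices.
\<close>

lemma ladder_commutator:
  assumes d: "distinct [i, j, k, l]"
  shows "commutator (raise2 i j * lower2 k l) (lower2 i j * raise2 k l) =
    qe * qe * qe * qe * (1 - qp 1) * (1 + qp 1) * qp (- 1) * (qp 2 * qnum2 1 i j * qnum2 1 k l) *
      ((qp 1 + qp (- 1)) * (qnum2 1 i j * qnum2 (- 1) k l - qnum2 (- 1) i j * qnum2 1 k l)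
       - (qp 1 * qnum2 (1/2) i j * qnum2 (1/2) k l + qp (- 1) * qnum2 (- 1/2) i j * qnum2 (- 1/2) k l +
         (qp 1 * qnum2 (1/2) i j * qnum2 (1/2) k l + qp (- 1) * qnum2 (- 1/2) i j * qnum2 (- 1/2) k l)) *
         (qnum2 (1/2) i j * qnum2 (- 1/2) k l - qnum2 (- 1/2) i j * qnum2 (1/2) k l))
    + qe * qe * (1 - qp 1) * (1 + qp 1) * qp (- 2) * (qp 2 * qnum2 1 i j * qnum2 1 k l) *
      ((qp (- 1) * qnum2 (- 1/2) i j * qnum2 (- 1/2) k l * (rot i j * rot i j)
        + qp 1 * qnum2 (1/2) i j * qnum2 (1/2) k l * (rot k l * rot k l)) * (qnum2 (1/2) i j * qnum2 (- 1/2) k l)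
       - (qp 1 * qnum2 (1/2) i j * qnum2 (1/2) k l * (rot i j * rot i j)
        + qp (- 1) * qnum2 (- 1/2) i j * qnum2 (- 1/2) k l * (rot k l * rot k l)) * (qnum2 (- 1/2) i j * qnum2 (1/2) k l))"
proof -
  from d have ij: "i \<noteq> j" and kl: "k \<noteq> l" and disj: "{k, l} \<inter> {i, j} = {}" by auto
  note cross = osc_on_commute[OF _ _ disj]
  \<comment> \<open>Interchanging the two middle factors brings each pair together, so that the
    one-pair formulas apply.\<close>
  have 1: "raise2 i j * lower2 k l * (lower2 i j * raise2 k l) =
      (raise2 i j * lower2 i j) * (lower2 k l * raise2 k l)"
    using cross[OF pair_osc_on(2) pair_osc_on(2)] by (metis mult.assoc)
  have 2: "lower2 i j * raise2 k l * (raise2 i j * lower2 k l) =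
      (lower2 i j * raise2 i j) * (raise2 k l * lower2 k l)"
    using cross[OF pair_osc_on(1) pair_osc_on(1)] by (metis mult.assoc)
  \<comment> \<open>Oriented to sort every monomial as \<open>qe\<close>, \<open>qp\<close>,
    \<open>qnum2\<close>, \<open>rot\<close>, with the pair \<open>i\<close>, \<open>j\<close>
    before \<open>k\<close>, \<open>l\<close> within the last two kinds.\<close>
  note c = cross[OF pair_osc_on(3) pair_osc_on(3)] cross[OF pair_osc_on(3) pair_osc_on(4)]
     cross[OF pair_osc_on(4) pair_osc_on(4)] cross[OF pair_osc_on(4) pair_osc_on(3), symmetric]
     rot_qnum2[OF ij] rot_qnum2[OF kl] pair_scalar qe_commute(5)
  show ?thesis
    unfolding commutator_def 1 2 raise2_lower2[OF ij] raise2_lower2[OF kl] lower2_raise2[OF ij] lower2_raise2[OF kl]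
    by (simp add: algebra_simps c c[THEN mult_left_eq] qp_mult qp_mult[THEN mult_left_eq] qp_zero
      qnum2_add[OF ij] qnum2_add[OF kl] qnum2_add[OF ij, THEN mult_left_eq]
      qnum2_add[OF kl, THEN mult_left_eq] qnum2_zero)
qed

section \<open>Translation of the operators of the theorem, and its proof\<close>

lemma osc_quadruple: "osc (\<lambda>h. 4 * f h) = osc f + osc f + osc f + osc f"
proof -
  have "4 * f h = f h + f h + f h + f h" for h
    using distrib_right[of 2 2 "f h"] by (simp add: mult_2 add.assoc)
  then show ?thesis by (simp add: osc_plus)
qed

lemma osc_scal: "osc (\<lambda>h. scal (qpow h c)) = qp c"
  by (simp add: qp_def sc_def)

lemma osc_Mplus: "osc Mplus = raise2 1 2 * lower2 3 4"
  unfolding Mplus_def[abs_def] raise2_def lower2_def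
  by (simp add: osc_hom osc_scal up_def dn_def qn_def mult.assoc)

lemma osc_Mminus: "osc Mminus = lower2 1 2 * raise2 3 4"
  unfolding Mminus_def[abs_def] raise2_def lower2_def
  by (simp add: osc_hom osc_scal up_def dn_def qn_def mult.assoc)

lemma osc_Lrot: "osc (\<lambda>h. Lrot h i) = rot i (i + 1)"
  unfolding Lrot_def rot_def
  by (simp add: osc_hom osc_scal up_def[symmetric] dn_def[symmetric] qn_def[symmetric] algebra_simps
    osc_normalize)

lemma osc_Lnum: "osc (\<lambda>h. Lnum) = (num 1 + num 2) - (num 3 + num 4)"
  unfolding Lnum_def by (simp only: osc_hom num_def)

lemma osc_Hnum: "osc (\<lambda>h. Hnum) = (num 1 + num 2) + (num 3 + num 4) + sc (\<lambda>h. 2)"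
proof -
  have "(\<Sum>i\<in>UNIV. A0 i + scal (1/2)) = (A0 1 + A0 2) + (A0 3 + A0 4) + (scal 2 :: 4 osc_free)"
    unfolding index_four(2)
    using index_four(1) by (simp add: scal_add algebra_simps)
  then show ?thesis
    unfolding Hnum_def by (simp add: osc_hom num_def sc_def)
qed

lemma osc_qL: "osc (\<lambda>h. qL c) = qnum2 c 1 2 * qnum2 (- c) 3 4"
  unfolding qL_def qnum2_def by (simp add: osc_hom qn_def mult.assoc)

lemma osc_qH: "osc (\<lambda>h. qH h c) = qp (2 * c) * qnum2 c 1 2 * qnum2 c 3 4"
  unfolding qH_def qnum2_def by (simp add: osc_hom osc_scal qn_def mult.assoc)

text \<open>Brings the rational coefficients of the theorem into the redundant form of
  \<open>ladder_commutator\<close>. The identities are between scalar functions and are checked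
  pointwise where \<open>exp h\<close> differs from 1.\<close>

lemma qe_power: "sc (\<lambda>h. (1 + exp h) / (exp h * (1 - exp h)^3)) =
    qe * qe * qe * qe * (1 - qp 1) * (1 + qp 1) * qp (- 1)"
  "sc (\<lambda>h. (1 + exp h) / ((exp h)^2 * (1 - exp h))) =
    qe * qe * (1 - qp 1) * (1 + qp 1) * qp (- 2)"
  unfolding qe_def qp_def sc_one[symmetric] sc_minus sc_mult sc_plus
  by (rule sc_cong; simp add: qpow_def exp_minus exp_double divide_simps power2_eq_square power3_eq_cube)+

theorem proposition2p1:
  fixes q h :: complex
  assumes "0 < norm q" and "norm q < 1"
    and "exp h = q"
  shows "commutator Lnum (Mplus h) \<approx>\<^bsub>h\<^esub> 4 * Mplus h
       \<and> commutator Lnum (Mminus h) \<approx>\<^bsub>h\<^esub> - 4 * Mminus h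
       \<and> commutator (Mplus h) (Mminus h) \<approx>\<^bsub>h\<^esub>
           scal ((1 + q) / (q * (1 - q)^3)) * qH h 1 *
             (scal (q + 1 / q) * (qL 1 - qL (- 1))
              - 2 * (qH h (1/2) + qH h (- 1/2)) * (qL (1/2) - qL (- 1/2)))
         + scal ((1 + q) / (q^2 * (1 - q))) * qH h 1 *
             ((qH h (- 1/2) * (Lrot h 1)^2 + qH h (1/2) * (Lrot h 3)^2) * qL (1/2)
              - (qH h (1/2) * (Lrot h 1)^2 + qH h (- 1/2) * (Lrot h 3)^2) * qL (- 1/2))
       \<and> (\<forall>x \<in> {Lrot h 1, Lrot h 3, Hnum}.
            \<forall>y \<in> {Lrot h 1, Lrot h 3, Hnum, Mplus h, Mminus h, Lnum}.
              x * y \<approx>\<^bsub>h\<^esub> y * x)"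
proof -
  \<comment> \<open>Since \<open>norm q < 1\<close>, the given \<open>h\<close> is not among the
    values disregarded in \<open>osc\<close>, so \<open>osc_eqD\<close> can specialise identities of
    families to it.\<close>
  have q1: "exp h \<noteq> 1" and q: "q = exp h" using assms by auto
  have d: "(1::4) \<noteq> 2" "(3::4) \<noteq> 4" "distinct [1, 2, 3, 4 :: 4]" "{1, 2} \<inter> {3, 4 :: 4} = {}"
    using index_four(1) by auto
  define N where "N = num 1 + num (2::4)"
  define N' where "N' = num 3 + num (4::4)"
  note up_N = raise2_num[OF d(1), folded N_def] raise2_num[OF d(2), folded N'_def]
  note dn_N = lower2_num[OF d(1), folded N_def] lower2_num[OF d(2), folded N'_def]
  note rot_N = rot_num[OF d(1), folded N_def] rot_num[OF d(2), folded N'_def]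
  note on = pair_osc_on[of 1 "2::4", folded N_def] pair_osc_on[of 3 "4::4", folded N'_def]
  note cross = osc_on_commute[OF _ _ d(4)]
  \<comment> \<open>Facts 1 to 5 of \<open>on\<close> concern \<open>raise2\<close>,
    \<open>lower2\<close>, \<open>rot\<close>, \<open>qnum2\<close> and the number operator of
    oscillators 1, 2; facts 6 to 10 concern those of 3, 4. The first pair is moved to the left,
    except that \<open>rot 1 2\<close> goes to the right of \<open>raise2 3 4\<close> and
    \<open>lower2 3 4\<close>, in line with \<open>rot_r\<close>.\<close>
  note cross' = cross[OF on(1) on(10), symmetric] cross[OF on(2) on(10), symmetric]
     cross[OF on(3) on(10), symmetric] cross[OF on(5) on(10), symmetric]
     cross[OF on(5) on(6), symmetric] cross[OF on(5) on(7), symmetric] cross[OF on(5) on(8), symmetric]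
     cross[OF on(1) on(8), symmetric] cross[OF on(2) on(8), symmetric] cross[OF on(3) on(8), symmetric]
     cross[OF on(3) on(6)] cross[OF on(3) on(7)]
  note rot_r = rot_raise2[OF d(1)] rot_raise2[OF d(2)] rot_lower2[OF d(1)] rot_lower2[OF d(2)]
  note L = osc_Lnum[folded N_def N'_def] and H = osc_Hnum[folded N_def N'_def]
  note rules = up_N dn_N rot_N cross' rot_r
  have LM: "osc (\<lambda>h. commutator Lnum (Mplus h)) = osc (\<lambda>h. 4 * Mplus h)"
    unfolding osc_quadruple commutator_def osc_hom osc_Mplus L
    by (simp add: algebra_simps rules rules[THEN mult_left_eq])
  have LM': "osc (\<lambda>h. commutator Lnum (Mminus h)) = osc (\<lambda>h. - 4 * Mminus h)"
    unfolding minus_mult_left[symmetric] osc_uminus osc_quadruple commutator_def osc_hom osc_Mminus L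
    by (simp add: algebra_simps rules rules[THEN mult_left_eq])
  have M: "osc (\<lambda>h. commutator (Mplus h) (Mminus h)) =
     osc (\<lambda>h. scal ((1 + exp h) / (exp h * (1 - exp h)^3)) * qH h 1 *
             (scal (exp h + 1 / exp h) * (qL 1 - qL (- 1))
              - 2 * (qH h (1/2) + qH h (- 1/2)) * (qL (1/2) - qL (- 1/2)))
         + scal ((1 + exp h) / ((exp h)^2 * (1 - exp h))) * qH h 1 *
             ((qH h (- 1/2) * (Lrot h 1)^2 + qH h (1/2) * (Lrot h 3)^2) * qL (1/2)
              - (qH h (1/2) * (Lrot h 1)^2 + qH h (- 1/2) * (Lrot h 3)^2) * qL (- 1/2)))"
  proof -
    have "sc (\<lambda>h. exp h + 1 / exp h) = qp 1 + (qp (- 1) :: 4 osc)"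
      by (simp add: qp_def sc_plus qpow_def exp_minus divide_inverse)
    then show ?thesis
      unfolding mult_2
      using ladder_commutator[OF d(3)]
      by (simp add: commutator_def osc_hom osc_Mplus osc_Mminus osc_Lrot osc_qL osc_qH
          sc_def[symmetric] qe_power)
  qed
  have C: "f h * g h \<approx>\<^bsub>h\<^esub> g h * f h"
    if "f \<in> {\<lambda>h. Lrot h 1, \<lambda>h. Lrot h 3, \<lambda>h. Hnum}"
      "g \<in> {\<lambda>h. Lrot h 1, \<lambda>h. Lrot h 3, \<lambda>h. Hnum, Mplus, Mminus, \<lambda>h. Lnum}" for f g
  proof -
    have r: "osc (\<lambda>h. Lrot h 1) = rot 1 2" "osc (\<lambda>h. Lrot h 3) = rot 3 4"
      by (simp_all add: osc_Lrot)
    \<comment> \<open>Besides the number operators, \<open>Hnum\<close> contributes the scalar 2,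
      the sum of the four halves; these rules move it to the left.\<close>
    note s = sc_central[OF on(1)] sc_central[OF on(2)] sc_central[OF on(3)] sc_central[OF on(5)]
      sc_central[OF on(6)] sc_central[OF on(7)] sc_central[OF on(8)] sc_central[OF on(10)]
    have "osc f * osc g = osc g * osc f"
      using that
      by (elim insertE emptyE; simp only: r H L osc_Mplus osc_Mminus;
          simp add: algebra_simps rules rules[THEN mult_left_eq] s[symmetric] s[symmetric, THEN mult_left_eq])
    then have "osc (\<lambda>h. f h * g h) = osc (\<lambda>h. g h * f h)"
      by (simp add: osc_times)
    from osc_eqD[OF this q1] show ?thesis .
  qed
  show ?thesis
    unfolding q
    using osc_eqD[OF LM q1] osc_eqD[OF LM' q1] osc_eqD[OF M q1]
    by (intro conjI) (use C in auto)
qed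

end
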